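(* Let $p\ge1$, let $\tilde S_c$ be a real symmetric $p\times p$ matrix (not necessarily positive semidefinite), let $\gamma_{c1}>0$ and $\gamma_{c2}>0$, and let $\Omega_c^*$ be the solution of $$\min_{\Omega\in\mathbb S^p_+}\left\{\operatorname{tr}(\tilde S_c\Omega)-\log\det(\Omega)+\gamma_{c1}\|\Omega\|_1+\gamma_{c2}\|\Omega\|_F^2\right\}.$$ Then $\alpha I\preceq\Omega_c^*\preceq\beta I$, where $$\alpha^{-1}=\tfrac12\Big(\rho_{1}(\tilde S_c)+\gamma_{c1}p+\sqrt{(\rho_{1}(\tilde S_c)+\gamma_{c1}p)^2+8\gamma_{c2}}\Big)$$ and $$\beta^{-1}=\tfrac12\Big(\rho_{p}(\tilde S_c)-\gamma_{c1}p+\sqrt{(\rho_{p}(\tilde S_c)-\gamma_{c1}p)^2+8\gamma_{c2}}\Big).$$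
   Context: $\mathbb S^p_+$ denotes the set of real symmetric positive definite $p\times p$ matrices. For a symmetric $p\times p$ matrix $A$, $\rho_1(A)\ge\cdots\ge\rho_p(A)$ are its ordered eigenvalues. $\|A\|_1=\sum_{j,k}|A_{jk}|$ is the entrywise $\ell_1$ norm and $\|A\|_F$ is the Frobenius norm. $A\preceq B$ means $B-A$ is positive semidefinite. *)

theory Defs
  imports "HOL-Analysis.Analysis" "HOL-Computational_Algebra.Computational_Algebra"
begin

definition char_polynomial :: "real^'n^'n \<Rightarrow> real poly" where
  "char_polynomial A = det (mat [:0, 1:] - (\<chi> i j. [:A $ i $ j:]))"

text \<open>
  The ordered eigenvalues \<open>\<rho>\<^sub>1 \<ge> \<rho>\<^sub>2 \<ge> \<dots>\<close>, indexed from 1 and listed with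
  multiplicity. For symmetric \<open>A\<close> the characteristic polynomial splits over the reals, so
  exactly the indices \<open>1, \<dots>, CARD('n)\<close> are meaningful.
\<close>

definition eigval :: "nat \<Rightarrow> real^'n^'n \<Rightarrow> real" where
  "eigval k A = rev (sorted_list_of_multiset (proots (char_polynomial A))) ! (k - 1)"

definition pos_semidef :: "real^'n^'n \<Rightarrow> bool" where
  "pos_semidef A \<longleftrightarrow> transpose A = A \<and> (\<forall>x. 0 \<le> x \<bullet> (A *v x))"

definition spd_matrices :: "(real^'n^'n) set" where
  "spd_matrices = {A. transpose A = A \<and> (\<forall>x. x \<noteq> 0 \<longrightarrow> 0 < x \<bullet> (A *v x))}"

definition loewner_le :: "real^'n^'n \<Rightarrow> real^'n^'n \<Rightarrow> bool"  (infix "\<preceq>" 50) where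
  "A \<preceq> B \<longleftrightarrow> pos_semidef (B - A)"

definition entrywise_l1_norm :: "real^'n^'n \<Rightarrow> real" where
  "entrywise_l1_norm A = (\<Sum>j\<in>UNIV. \<Sum>k\<in>UNIV. \<bar>A $ j $ k\<bar>)"

definition frobenius_norm :: "real^'n^'n \<Rightarrow> real" where
  "frobenius_norm A = sqrt (\<Sum>j\<in>UNIV. \<Sum>k\<in>UNIV. (A $ j $ k)\<^sup>2)"

lemma frobenius_norm_eq_norm: "frobenius_norm A = norm A"
  by (simp add: frobenius_norm_def norm_vec_def L2_set_def sum_nonneg)

definition penalized_objective ::
    "real^'n^'n \<Rightarrow> real \<Rightarrow> real \<Rightarrow> real^'n^'n \<Rightarrow> real" where
  "penalized_objective S \<gamma>1 \<gamma>2 \<Omega> =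
     trace (S ** \<Omega>) - ln (det \<Omega>)
       + \<gamma>1 * entrywise_l1_norm \<Omega> + \<gamma>2 * (frobenius_norm \<Omega>)\<^sup>2"

end

theory Submission imports Defs begin

text \<open>
  If \<open>q\<close> is a unit eigenvector of the minimizer \<open>\<Omega>\<close> with eigenvalue \<open>\<delta>\<close>, then
  \<open>det (\<Omega> + t q q\<^sup>T) = (1 + t / \<delta>) det \<Omega>\<close>, and the \<open>\<ell>\<^sub>1\<close> norm of \<open>q q\<^sup>T\<close> is at most \<open>p\<close>
  by Cauchy-Schwarz. Hence optimality of \<open>\<Omega>\<close> along \<open>t \<mapsto> \<Omega> + t q q\<^sup>T\<close>, for small \<open>t\<close> of
  either sign, gives \<open>\<bar>q\<^sup>T S q - 1 / \<delta> + 2 \<gamma>\<^sub>2 \<delta>\<bar> \<le> \<gamma>\<^sub>1 p\<close>. As \<open>q\<^sup>T S q\<close> lies between the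
  extreme eigenvalues of \<open>S\<close>, the number \<open>u = 1 / \<delta>\<close> satisfies two quadratic inequalities,
  whose positive roots are \<open>1 / \<alpha>\<close> and \<open>1 / \<beta>\<close>.
\<close>

no_notation fps_nth (infixl "$" 75)

section \<open>Orthonormal eigenbases of symmetric matrices\<close>

lemma symmetric_matrix_inner:
  fixes A :: "real^'n^'n"
  assumes "transpose A = A"
  shows "(A *v x) \<bullet> y = x \<bullet> (A *v y)"
  by (metis assms dot_lmul_matrix vector_transpose_matrix)

text \<open>A maximizer of the quadratic form on the unit sphere of \<open>V\<close> is an
  eigenvector: otherwise a small move along the residual \<open>A *v v - c *\<^sub>R v\<close>,
  which stays in \<open>V\<close> by invariance, would raise the Rayleigh quotient.\<close>

lemma symmetric_eigenvector_in_invariant_subspace: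
  fixes A :: "real^'n^'n"
  assumes A: "transpose A = A" and V: "subspace V" and inv: "\<And>x. x \<in> V \<Longrightarrow> A *v x \<in> V"
    and ne: "u \<in> V" "u \<noteq> 0"
  obtains v c where "v \<in> V" "norm v = 1" "A *v v = c *\<^sub>R v"
proof -
  let ?K = "V \<inter> sphere 0 1"
  have "compact ?K"
    using closed_subspace[OF V] by (simp add: closed_Int_compact)
  moreover have "u /\<^sub>R norm u \<in> ?K"
    using ne V by (simp add: subspace_scale)
  then have "?K \<noteq> {}" by blast
  moreover have "continuous_on ?K (\<lambda>x. x \<bullet> (A *v x))"
    by (intro continuous_intros matrix_vector_mult_linear_continuous_on)
  ultimately obtain v where v: "v \<in> ?K" "\<And>y. y \<in> ?K \<Longrightarrow> y \<bullet> (A *v y) \<le> v \<bullet> (A *v v)"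
    using continuous_attains_sup[of ?K "\<lambda>x. x \<bullet> (A *v x)"] by blast
  define c where "c = v \<bullet> (A *v v)"
  have vv: "v \<bullet> v = 1" using v(1) by (simp add: norm_eq_1)
  \<comment> \<open>Homogeneity of degree two carries the maximum from the unit sphere to all of
    \<open>V\<close>.\<close>
  have ray: "y \<bullet> (A *v y) \<le> c * (y \<bullet> y)" if "y \<in> V" for y
  proof (cases "y = 0")
    case False
    have "y /\<^sub>R norm y \<in> ?K" using that False V by (simp add: subspace_scale)
    from v(2)[OF this] have "(y \<bullet> (A *v y)) / (norm y)\<^sup>2 \<le> c"
      by (simp add: c_def matrix_vector_mult_scaleR power2_eq_square divide_inverse mult_ac)
    then show ?thesis using False by (simp add: dot_square_norm divide_simps mult_ac)
  qed simp
  define w where "w = A *v v - c *\<^sub>R v"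
  have wV: "w \<in> V" using v(1) inv V by (simp add: w_def subspace_diff subspace_scale)
  define C where "C = c * (w \<bullet> w) - w \<bullet> (A *v w)"
  have C: "0 \<le> C" using ray[OF wV] by (simp add: C_def)
  \<comment> \<open>The term \<open>c * (w \<bullet> v)\<close> cancels when \<open>ray\<close> is
    applied to \<open>v + t *\<^sub>R w\<close>, leaving \<open>w \<bullet> w\<close> as the
    first-order gain.\<close>
  have wAv: "w \<bullet> (A *v v) = w \<bullet> w + c * (w \<bullet> v)"
    by (simp add: w_def algebra_simps)
  \<comment> \<open>Small enough that \<open>t * C\<close> is at most \<open>w \<bullet> w\<close>,
    so the second-order loss cannot absorb the first-order gain
    \<open>2 * t * (w \<bullet> w)\<close>. The summand 1 covers \<open>C = 0\<close>.\<close>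
  define t where "t = (w \<bullet> w) / (C + 1)"
  have "v + t *\<^sub>R w \<in> V" using v(1) wV V by (simp add: subspace_add subspace_scale)
  from ray[OF this] have "c + 2 * t * (w \<bullet> (A *v v)) + t\<^sup>2 * (w \<bullet> (A *v w))
      \<le> c * (1 + 2 * t * (w \<bullet> v) + t\<^sup>2 * (w \<bullet> w))"
    using symmetric_matrix_inner[OF A, of w v]
    by (simp add: algebra_simps matrix_vector_right_distrib matrix_vector_mult_scaleR
        c_def[symmetric] vv power2_eq_square inner_commute)
  then have "2 * t * (w \<bullet> w) \<le> t * (t * C)"
    unfolding wAv C_def by (simp add: algebra_simps power2_eq_square)
  moreover have "t * C \<le> w \<bullet> w" using C by (simp add: t_def field_simps)
  moreover have "0 \<le> t" using C by (simp add: t_def)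
  ultimately have "2 * t * (w \<bullet> w) \<le> t * (w \<bullet> w)"
    by (meson mult_left_mono order_trans)
  then have "t * (w \<bullet> w) \<le> 0" by simp
  then have "(w \<bullet> w)\<^sup>2 \<le> 0" using C by (simp add: t_def power2_eq_square divide_le_0_iff)
  then have "w = 0" by simp
  then have "A *v v = c *\<^sub>R v" by (simp add: w_def)
  moreover have "v \<in> V" "norm v = 1" using v(1) by auto
  ultimately show thesis by (intro that)
qed

text \<open>Indexing by the coordinate type makes such a family a full basis and the matrix with
  these columns square.\<close>

definition orthonormal_family :: "('n \<Rightarrow> real^'n) \<Rightarrow> bool" where
  "orthonormal_family q \<longleftrightarrow> (\<forall>i j. q i \<bullet> q j = (if i = j then 1 else 0))"

text \<open>Eigenvectors are added one index at a time. By symmetry the orthogonal complement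
  \<open>V\<close> of those already found is invariant, and it is nonzero as long as an index is
  missing, so it contains a further eigenvector.\<close>

lemma orthonormal_eigenbasis_exists:
  fixes A :: "real^'n^'n"
  assumes A: "transpose A = A"
  obtains q d where "orthonormal_family q" "\<And>i. A *v q i = d i *\<^sub>R q i"
proof -
  have "\<exists>q d. \<forall>i\<in>I. A *v q i = d i *\<^sub>R q i \<and> (\<forall>j\<in>I. q i \<bullet> q j = (if i = j then 1 else 0))"
    for I :: "'n set"
    using finite[of I]
  proof (induction I rule: finite_induct)
    case (insert k I)
    then obtain q :: "'n \<Rightarrow> real^'n" and d where
      q: "\<And>i. i \<in> I \<Longrightarrow> A *v q i = d i *\<^sub>R q i"
        "\<And>i j. \<lbrakk>i \<in> I; j \<in> I\<rbrakk> \<Longrightarrow> q i \<bullet> q j = (if i = j then 1 else 0)"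
      by metis
    define V where "V = {x. \<forall>i\<in>I. q i \<bullet> x = 0}"
    have V: "subspace V" by (simp add: V_def subspace_def inner_add_right)
    have inv: "A *v x \<in> V" if "x \<in> V" for x
      using that q(1) by (simp add: V_def symmetric_matrix_inner[OF A, symmetric])
    have "dim (q ` I) \<le> card (q ` I)" by (simp add: dim_le_card')
    also have "\<dots> \<le> card I" by (simp add: card_image_le)
    also have "\<dots> < card (UNIV :: 'n set)"
      using insert.hyps by (intro psubset_card_mono) auto
    finally have "dim (q ` I) < DIM(real^'n)" by simp
    then obtain u where u: "u \<noteq> 0" "\<And>y. y \<in> span (q ` I) \<Longrightarrow> orthogonal u y"
      by (metis orthogonal_to_subspace_exists)
    have "q i \<bullet> u = 0" if "i \<in> I" for i
      using u(2)[of "q i"] that by (metis imageI inner_commute orthogonal_def span_base)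
    then have "u \<in> V" by (simp add: V_def)
    then obtain v c where v: "v \<in> V" "norm v = 1" "A *v v = c *\<^sub>R v"
      using symmetric_eigenvector_in_invariant_subspace[OF A V inv] u(1) by metis
    have "v \<bullet> v = 1" using v(2) by (simp add: norm_eq_1)
    moreover have "q i \<bullet> v = 0" "v \<bullet> q i = 0" if "i \<in> I" for i
      using v(1) that by (auto simp: V_def inner_commute)
    ultimately show ?case
      using q v insert.hyps
      by (intro exI[of _ "q(k := v)"] exI[of _ "d(k := c)"]) auto
  qed simp
  from this[of UNIV] show thesis using that by (auto simp: orthonormal_family_def)
qed

section \<open>Matrices given by an orthonormal family and its coefficients\<close>

text \<open>This is \<open>Q D Q^T\<close>, where \<open>Q\<close> has the columns
  \<open>q i\<close> and \<open>D\<close> is diagonal with entries \<open>d i\<close>.\<close>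

definition spectral_matrix :: "('n \<Rightarrow> real^'n) \<Rightarrow> ('n \<Rightarrow> real) \<Rightarrow> real^'n^'n" where
  "spectral_matrix q d = (\<chi> j k. \<Sum>i\<in>UNIV. d i * q i $ j * q i $ k)"

definition outer :: "real^'n \<Rightarrow> real^'n^'n" where
  "outer v = (\<chi> j k. v $ j * v $ k)"

lemma spectral_matrix_factorization:
  "spectral_matrix q d = (\<chi> j i. q i $ j) ** (\<chi> i j. if i = j then d i else 0) ** transpose (\<chi> j i. q i $ j)"
  by (simp add: spectral_matrix_def matrix_matrix_mult_def transpose_def vec_eq_iff
      if_distrib[of "(*) _"] mult.commute cong: if_cong)

lemma orthogonal_matrix_of_orthonormal_family:
  assumes "orthonormal_family q"
  shows "orthogonal_matrix (\<chi> j i. q i $ j)"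
  using assms
  by (simp add: orthogonal_matrix matrix_matrix_mult_def transpose_def vec_eq_iff mat_def
      orthonormal_family_def inner_vec_def)

lemma det_spectral_matrix:
  assumes "orthonormal_family q"
  shows "det (spectral_matrix q d) = (\<Prod>i\<in>UNIV. d i)"
proof -
  let ?Q = "\<chi> j i. q i $ j"
  have "det ?Q * det ?Q = det (transpose ?Q ** ?Q)" by (simp add: det_mul)
  also have "\<dots> = 1"
    using orthogonal_matrix_of_orthonormal_family[OF assms] by (simp add: orthogonal_matrix)
  finally have "det ?Q * det ?Q = 1" .
  moreover have "det (spectral_matrix q d) = (det ?Q * det ?Q) * (\<Prod>i\<in>UNIV. d i)"
    by (simp add: spectral_matrix_factorization det_mul det_diagonal)
  ultimately show ?thesis by simp
qed

text \<open>This is completeness of the family, from \<open>Q Q^T = I\<close>. Scalar matrices can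
  thus be written in any eigenbasis, and comparing with them reduces to comparing
  coefficients.\<close>

lemma spectral_matrix_const:
  assumes "orthonormal_family q"
  shows "spectral_matrix q (\<lambda>_. c) = c *\<^sub>R mat 1"
proof -
  have "(\<chi> j i. q i $ j) ** transpose (\<chi> j i. q i $ j) = (mat 1 :: real^'a^'a)"
    using orthogonal_matrix_of_orthonormal_family[OF assms] by (simp add: orthogonal_matrix_def)
  then show ?thesis
    by (simp add: spectral_matrix_def matrix_matrix_mult_def transpose_def vec_eq_iff mult.assoc
        sum_distrib_left[symmetric])
qed

lemma spectral_matrix_diff:
  "spectral_matrix q d - spectral_matrix q e = spectral_matrix q (\<lambda>i. d i - e i)"
  by (simp add: spectral_matrix_def vec_eq_iff sum_subtractf algebra_simps)

text \<open>The perturbed matrix keeps its eigenbasis, so its determinant and definiteness can be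
  read off the coefficients.\<close>

lemma spectral_matrix_update:
  "spectral_matrix q (d(i := d i + t)) = spectral_matrix q d + t *\<^sub>R outer (q i)"
proof -
  have "(\<Sum>l\<in>UNIV. (d(i := d i + t)) l * q l $ j * q l $ k)
      = (\<Sum>l\<in>UNIV. d l * q l $ j * q l $ k + (if l = i then t * q i $ j * q i $ k else 0))" for j k
    by (rule sum.cong) (auto simp: algebra_simps)
  then show ?thesis
    by (simp add: spectral_matrix_def outer_def vec_eq_iff sum.distrib mult.assoc)
qed

lemma transpose_spectral_matrix: "transpose (spectral_matrix q d) = spectral_matrix q d"
  by (simp add: spectral_matrix_def transpose_def vec_eq_iff mult_ac)

lemma spectral_matrix_mult_vec:
  "spectral_matrix q d *v x = (\<Sum>i\<in>UNIV. (d i * (q i \<bullet> x)) *\<^sub>R q i)"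
proof -
  have "(\<Sum>k\<in>UNIV. (\<Sum>i\<in>UNIV. d i * q i $ j * q i $ k) * x $ k)
      = (\<Sum>i\<in>UNIV. d i * (q i \<bullet> x) * q i $ j)" for j
    unfolding inner_vec_def sum_distrib_left sum_distrib_right
    by (subst sum.swap) (simp add: mult_ac)
  then show ?thesis
    by (simp add: spectral_matrix_def matrix_vector_mult_def vec_eq_iff)
qed

lemma spectral_matrix_form:
  "x \<bullet> (spectral_matrix q d *v x) = (\<Sum>i\<in>UNIV. d i * (q i \<bullet> x)\<^sup>2)"
  by (simp add: spectral_matrix_mult_vec inner_sum_right power2_eq_square inner_commute mult.assoc)

lemma spectral_matrix_form_eigenvector:
  assumes "orthonormal_family q"
  shows "q i \<bullet> (spectral_matrix q d *v q i) = d i"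
proof -
  have "q i \<bullet> (spectral_matrix q d *v q i) = (\<Sum>j\<in>UNIV. if j = i then d i else 0)"
    unfolding spectral_matrix_form using assms by (intro sum.cong) (auto simp: orthonormal_family_def)
  then show ?thesis by simp
qed

text \<open>Parseval's identity, read off the quadratic form of the identity matrix.\<close>

lemma orthonormal_family_norm:
  assumes "orthonormal_family q"
  shows "x \<bullet> x = (\<Sum>i\<in>UNIV. (q i \<bullet> x)\<^sup>2)"
  using spectral_matrix_form[of x q "\<lambda>_. 1"] by (simp add: spectral_matrix_const[OF assms])

lemma spectral_decomposition:
  fixes A :: "real^'n^'n"
  assumes A: "transpose A = A"
  obtains q d where "orthonormal_family q" "A = spectral_matrix q d"
proof -
  obtain q d where q: "orthonormal_family q" "\<And>i. A *v q i = d i *\<^sub>R q i"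
    using orthonormal_eigenbasis_exists[OF A] by metis
  have "A *v x = spectral_matrix q d *v x" for x
  proof -
    \<comment> \<open>Applying the identity matrix, in the form with all coefficients 1, expands
      \<open>x\<close> in the eigenbasis.\<close>
    have "A *v x = A *v (\<Sum>i\<in>UNIV. (q i \<bullet> x) *\<^sub>R q i)"
      using spectral_matrix_mult_vec[of q "\<lambda>_. 1" x] by (simp add: spectral_matrix_const[OF q(1)])
    also have "\<dots> = (\<Sum>i\<in>UNIV. (q i \<bullet> x) *\<^sub>R (A *v q i))"
      by (simp add: linear_sum[OF matrix_vector_mul_linear] matrix_vector_mult_scaleR)
    also have "\<dots> = spectral_matrix q d *v x"
      by (simp add: spectral_matrix_mult_vec q(2) mult.commute)
    finally show ?thesis .
  qed
  then have "A = spectral_matrix q d" by (simp add: matrix_eq)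
  then show thesis using that q(1) by blast
qed

section \<open>Ordered eigenvalues and Rayleigh bounds\<close>

lemma poly_char_polynomial: "poly (char_polynomial A) x = det (x *\<^sub>R mat 1 - A)"
proof -
  have "poly ((mat [:0, 1:] - (\<chi> i j. [:A $ i $ j:])) $ i $ j) x = (x *\<^sub>R mat 1 - A) $ i $ j" for i j
    by (simp add: mat_def)
  then show ?thesis
    by (simp add: char_polynomial_def det_def poly_sum poly_prod)
qed

text \<open>Real polynomials that agree at every point are equal, and at \<open>x\<close> the left
  side is the determinant of a spectral matrix with coefficients \<open>x - d i\<close>.\<close>

lemma char_polynomial_spectral_matrix:
  assumes "orthonormal_family q"
  shows "char_polynomial (spectral_matrix q d) = (\<Prod>i\<in>UNIV. [:- d i, 1:])"
proof -
  have "poly (char_polynomial (spectral_matrix q d)) x = poly (\<Prod>i\<in>UNIV. [:- d i, 1:]) x" for x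
    by (simp add: poly_char_polynomial spectral_matrix_const[OF assms, symmetric]
        spectral_matrix_diff det_spectral_matrix[OF assms] poly_prod)
  then show ?thesis by (simp add: poly_eq_poly_eq_iff[symmetric] fun_eq_iff)
qed

text \<open>The coefficients, with multiplicity, are exactly the roots of the characteristic
  polynomial, so the first and last ordered eigenvalues are their maximum and minimum.\<close>

lemma eigval_spectral_matrix_bounds:
  fixes q :: "'n \<Rightarrow> real^'n"
  assumes "orthonormal_family q"
  shows "d i \<le> eigval 1 (spectral_matrix q d)"
    and "eigval CARD('n) (spectral_matrix q d) \<le> d i"
proof -
  define xs where "xs = sorted_list_of_multiset (proots (char_polynomial (spectral_matrix q d)))"
  have roots: "proots (char_polynomial (spectral_matrix q d)) = image_mset d (mset_set UNIV)"
  proof -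
    have "proots (char_polynomial (spectral_matrix q d)) = (\<Sum>i\<in>UNIV. {#d i#})"
      by (simp add: char_polynomial_spectral_matrix[OF assms] proots_prod)
    then show ?thesis by (simp add: sum_unfold_sum_mset)
  qed
  have mset: "mset xs = image_mset d (mset_set UNIV)" by (simp add: xs_def roots)
  have len: "length xs = CARD('n)"
    using arg_cong[OF mset, of size] by simp
  have "d i \<in> set xs"
    using arg_cong[OF mset, of set_mset] by simp
  then obtain m where m: "m < length xs" "d i = xs ! m" by (metis in_set_conv_nth)
  have "sorted xs" by (simp add: xs_def)
  then have "xs ! 0 \<le> xs ! m" "xs ! m \<le> xs ! (length xs - 1)"
    using m(1) by (auto intro!: sorted_nth_mono)
  \<comment> \<open>\<open>xs\<close> is ascending and \<open>eigval\<close> reverses it, so index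
    \<open>k\<close> reads position \<open>length xs - k\<close>: the last entry for 1, the entry at
    0 for \<open>CARD('n)\<close>.\<close>
  moreover have "eigval 1 (spectral_matrix q d) = xs ! (length xs - 1)"
    "eigval CARD('n) (spectral_matrix q d) = xs ! 0"
    using m(1) len by (simp_all add: eigval_def xs_def[symmetric] rev_nth)
  ultimately show "d i \<le> eigval 1 (spectral_matrix q d)"
    and "eigval CARD('n) (spectral_matrix q d) \<le> d i" using m(2) by simp_all
qed

text \<open>In an eigenbasis the form is an average of the eigenvalues with weights
  \<open>(q i \<bullet> v)\<^sup>2\<close>, which sum to 1 by Parseval.\<close>

lemma rayleigh_bounds:
  fixes A :: "real^'n^'n"
  assumes "transpose A = A" and v: "norm v = 1"
  shows "v \<bullet> (A *v v) \<le> eigval 1 A" and "eigval CARD('n) A \<le> v \<bullet> (A *v v)"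
proof -
  obtain q d where q: "orthonormal_family q" "A = spectral_matrix q d"
    using spectral_decomposition[OF assms(1)] by metis
  have v1: "(\<Sum>i\<in>UNIV. (q i \<bullet> v)\<^sup>2) = 1"
    using v orthonormal_family_norm[OF q(1), of v] by (simp add: norm_eq_1)
  have "v \<bullet> (A *v v) = (\<Sum>i\<in>UNIV. d i * (q i \<bullet> v)\<^sup>2)"
    by (simp add: q(2) spectral_matrix_form)
  also have "\<dots> \<le> (\<Sum>i\<in>UNIV. eigval 1 A * (q i \<bullet> v)\<^sup>2)"
    using eigval_spectral_matrix_bounds(1)[OF q(1)] q(2) by (intro sum_mono mult_right_mono) auto
  finally show "v \<bullet> (A *v v) \<le> eigval 1 A" by (simp add: sum_distrib_left[symmetric] v1)
  have "(\<Sum>i\<in>UNIV. eigval CARD('n) A * (q i \<bullet> v)\<^sup>2) \<le> (\<Sum>i\<in>UNIV. d i * (q i \<bullet> v)\<^sup>2)"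
    using eigval_spectral_matrix_bounds(2)[OF q(1)] q(2) by (intro sum_mono mult_right_mono) auto
  also have "\<dots> = v \<bullet> (A *v v)"
    by (simp add: q(2) spectral_matrix_form)
  finally show "eigval CARD('n) A \<le> v \<bullet> (A *v v)" by (simp add: sum_distrib_left[symmetric] v1)
qed

section \<open>Definiteness read off the coefficients\<close>

lemma spectral_matrix_loewner:
  assumes "orthonormal_family q"
  shows "(\<And>i. a \<le> d i) \<Longrightarrow> a *\<^sub>R mat 1 \<preceq> spectral_matrix q d"
    and "(\<And>i. d i \<le> b) \<Longrightarrow> spectral_matrix q d \<preceq> b *\<^sub>R mat 1"
  unfolding loewner_le_def pos_semidef_def spectral_matrix_const[OF assms, symmetric]
    spectral_matrix_diff transpose_spectral_matrix spectral_matrix_form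
  by (simp_all add: sum_nonneg)

lemma spectral_matrix_spd_iff:
  assumes q: "orthonormal_family q"
  shows "spectral_matrix q d \<in> spd_matrices \<longleftrightarrow> (\<forall>i. 0 < d i)"
proof
  assume spd: "spectral_matrix q d \<in> spd_matrices"
  show "\<forall>i. 0 < d i"
  proof
    fix i
    have "q i \<bullet> q i = 1" using q by (simp add: orthonormal_family_def)
    then have "q i \<noteq> 0" by auto
    then have "0 < q i \<bullet> (spectral_matrix q d *v q i)" using spd by (simp add: spd_matrices_def)
    then show "0 < d i" by (simp add: spectral_matrix_form_eigenvector[OF q])
  qed
next
  assume d: "\<forall>i. 0 < d i"
  have "0 < x \<bullet> (spectral_matrix q d *v x)" if "x \<noteq> 0" for x
  proof -
    \<comment> \<open>By Parseval a nonzero vector has a nonzero coordinate, which makes one term of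
      the form strictly positive.\<close>
    have "(\<Sum>i\<in>UNIV. (q i \<bullet> x)\<^sup>2) \<noteq> 0"
      using that orthonormal_family_norm[OF q, of x] by (metis inner_eq_zero_iff)
    then obtain i where "q i \<bullet> x \<noteq> 0" by (metis (no_types, lifting) power_zero_numeral sum.neutral)
    then show ?thesis
      unfolding spectral_matrix_form using d by (intro sum_pos2[of _ i]) (auto simp: less_imp_le)
  qed
  then show "spectral_matrix q d \<in> spd_matrices"
    by (simp add: spd_matrices_def transpose_spectral_matrix)
qed

section \<open>The objective under a rank-one update\<close>

lemma entrywise_l1_norm_add_le:
  "entrywise_l1_norm (A + B) \<le> entrywise_l1_norm A + entrywise_l1_norm B"
  by (simp add: entrywise_l1_norm_def sum.distrib[symmetric] sum_mono abs_triangle_ineq)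

text \<open>The double sum factors into the square of the l1 norm of \<open>v\<close>, to which
  Cauchy-Schwarz applies.\<close>

lemma entrywise_l1_norm_outer_le:
  fixes v :: "real^'n"
  shows "entrywise_l1_norm (t *\<^sub>R outer v) \<le> \<bar>t\<bar> * (real CARD('n) * (norm v)\<^sup>2)"
proof -
  have "entrywise_l1_norm (t *\<^sub>R outer v) = \<bar>t\<bar> * (\<Sum>j\<in>UNIV. \<bar>v $ j\<bar>)\<^sup>2"
    by (simp add: entrywise_l1_norm_def outer_def abs_mult power2_eq_square sum_product
        sum_distrib_left[symmetric])
  also have "(\<Sum>j\<in>UNIV. \<bar>v $ j\<bar>)\<^sup>2 \<le> real CARD('n) * (norm v)\<^sup>2"
    using sum_squared_le_sum_of_squares[of "\<lambda>j. \<bar>v $ j\<bar>" UNIV]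
    by (simp add: norm_vec_def L2_set_def sum_nonneg mult.commute)
  finally show ?thesis by (simp add: mult_left_mono)
qed

text \<open>The inner product on matrices is the one inducing the Frobenius norm; this gives the
  cross term when its square is expanded.\<close>

lemma inner_outer: "A \<bullet> outer v = v \<bullet> (A *v v)"
  by (simp add: inner_vec_def outer_def matrix_vector_mult_def sum_distrib_left mult_ac)

lemma trace_mult_outer: "trace (S ** outer v) = v \<bullet> (S *v v)"
  by (simp add: trace_def matrix_matrix_mult_def outer_def inner_vec_def matrix_vector_mult_def
      sum_distrib_left mult_ac)

lemma frobenius_norm_update:
  assumes "norm v = 1"
  shows "(frobenius_norm (A + t *\<^sub>R outer v))\<^sup>2 = (frobenius_norm A)\<^sup>2 + 2 * t * (v \<bullet> (A *v v)) + t\<^sup>2"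
proof -
  \<comment> \<open>For a unit vector, \<open>outer v\<close> is the projection onto its line, so
    its Frobenius norm is 1.\<close>
  have "outer v *v v = v"
    using assms by (simp add: outer_def matrix_vector_mult_def vec_eq_iff mult.assoc
        sum_distrib_left[symmetric] norm_eq_1 inner_vec_def)
  then have "outer v \<bullet> outer v = 1"
    using assms by (simp add: inner_outer norm_eq_1)
  then show ?thesis
    unfolding frobenius_norm_eq_norm power2_norm_eq_inner inner_outer[symmetric]
    by (simp add: inner_add_left inner_add_right inner_commute[of "outer v" A] power2_eq_square distrib_left)
qed

text \<open>The trace, determinant and Frobenius terms change by exactly computable amounts; only
  the l1 term is estimated, by the triangle inequality. An upper bound suffices for comparison with
  a minimizer.\<close>

lemma penalized_objective_update_le:
  fixes S :: "real^'n^'n"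
  assumes q: "orthonormal_family q" and d: "\<And>j. 0 < d j" "0 < d i + t" and "0 \<le> \<gamma>1"
  shows "penalized_objective S \<gamma>1 \<gamma>2 (spectral_matrix q d + t *\<^sub>R outer (q i))
    \<le> penalized_objective S \<gamma>1 \<gamma>2 (spectral_matrix q d)
      + t * (q i \<bullet> (S *v q i)) - ln (1 + t / d i) + \<gamma>1 * real CARD('n) * \<bar>t\<bar>
      + \<gamma>2 * (2 * t * d i + t\<^sup>2)"
proof -
  let ?A = "spectral_matrix q d"
  have n: "norm (q i) = 1" using q by (simp add: orthonormal_family_def norm_eq_1)
  have tr: "trace (S ** (?A + t *\<^sub>R outer (q i))) = trace (S ** ?A) + t * (q i \<bullet> (S *v q i))"
    by (simp add: matrix_add_ldistrib trace_add trace_mult_outer[symmetric] trace_def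
        sum_distrib_left matrix_matrix_mult_def sum.distrib distrib_left mult.left_commute)
  have "det (?A + t *\<^sub>R outer (q i)) = (\<Prod>j\<in>UNIV. (d(i := d i + t)) j)"
    by (simp add: spectral_matrix_update[symmetric] det_spectral_matrix[OF q])
  also have "\<dots> = (d i + t) * (\<Prod>j\<in>UNIV - {i}. d j)"
    by (simp add: prod.remove[of _ i])
  also have "\<dots> = (1 + t / d i) * (\<Prod>j\<in>UNIV. d j)"
    using d(1)[of i] by (simp add: prod.remove[of _ i] field_simps)
  also have "\<dots> = (1 + t / d i) * det ?A"
    by (simp add: det_spectral_matrix[OF q])
  finally have det: "det (?A + t *\<^sub>R outer (q i)) = (1 + t / d i) * det ?A" .
  have "0 < det ?A" using d(1) by (simp add: det_spectral_matrix[OF q] prod_pos)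
  moreover have "0 < 1 + t / d i" using d(1)[of i] d(2) by (simp add: field_simps)
  ultimately have ln: "ln (det (?A + t *\<^sub>R outer (q i))) = ln (1 + t / d i) + ln (det ?A)"
    by (simp add: det ln_mult)
  have fr: "(frobenius_norm (?A + t *\<^sub>R outer (q i)))\<^sup>2 = (frobenius_norm ?A)\<^sup>2 + (2 * t * d i + t\<^sup>2)"
    by (simp add: frobenius_norm_update[OF n] spectral_matrix_form_eigenvector[OF q])
  have "entrywise_l1_norm (?A + t *\<^sub>R outer (q i)) \<le> entrywise_l1_norm ?A + \<bar>t\<bar> * real CARD('n)"
    using entrywise_l1_norm_add_le[of ?A "t *\<^sub>R outer (q i)"] entrywise_l1_norm_outer_le[of t "q i"] n
    by simp
  from mult_left_mono[OF this \<open>0 \<le> \<gamma>1\<close>] show ?thesis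
    unfolding penalized_objective_def tr ln fr by (simp add: algebra_simps)
qed

section \<open>First-order condition at the minimizer\<close>

text \<open>Here \<open>g\<close> is the derivative of the smooth part along the update. The l1 term
  can have a kink, so \<open>g\<close> need not vanish; comparing with steps \<open>t\<close> and
  \<open>- t\<close> and letting the second-order error tend to 0 bounds it on both sides.\<close>

lemma minimizer_stationarity:
  fixes S :: "real^'n^'n"
  assumes q: "orthonormal_family q" and d: "\<And>j. 0 < d j" and "0 \<le> \<gamma>1"
    and min: "is_arg_min (penalized_objective S \<gamma>1 \<gamma>2) (\<lambda>\<Theta>. \<Theta> \<in> spd_matrices) (spectral_matrix q d)"
  shows "\<bar>q i \<bullet> (S *v q i) - 1 / d i + 2 * \<gamma>2 * d i\<bar> \<le> \<gamma>1 * real CARD('n)"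
proof -
  define g where "g = q i \<bullet> (S *v q i) - 1 / d i + 2 * \<gamma>2 * d i"
  \<comment> \<open>The coefficient of \<open>t\<^sup>2\<close>: the remainder
    \<open>2 * (t / d i)\<^sup>2\<close> of the logarithm plus the quadratic part of the Frobenius
    penalty.\<close>
  define C where "C = 2 / (d i)\<^sup>2 + \<bar>\<gamma>2\<bar>"
  have C: "0 \<le> C" by (simp add: C_def)
  \<comment> \<open>The range of \<open>t\<close> keeps \<open>d i + t\<close> positive and puts
    \<open>t / d i\<close> within the radius 1/2 of the logarithm estimate.\<close>
  have key: "0 \<le> t * g + \<gamma>1 * real CARD('n) * \<bar>t\<bar> + C * t\<^sup>2" if t: "\<bar>t\<bar> \<le> d i / 2" for t
  proof -
    have pos: "0 < d i + t" using t d[of i] by linarith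
    have "spectral_matrix q d + t *\<^sub>R outer (q i) \<in> spd_matrices"
      using d pos by (simp add: spectral_matrix_update[symmetric] spectral_matrix_spd_iff[OF q])
    then have "penalized_objective S \<gamma>1 \<gamma>2 (spectral_matrix q d)
        \<le> penalized_objective S \<gamma>1 \<gamma>2 (spectral_matrix q d + t *\<^sub>R outer (q i))"
      using min by (simp add: is_arg_min_linorder)
    with penalized_objective_update_le[where S=S and q=q and d=d and i=i and t=t and ?\<gamma>1.0=\<gamma>1 and ?\<gamma>2.0=\<gamma>2] q d pos \<open>0 \<le> \<gamma>1\<close>
    have "ln (1 + t / d i) \<le> t * (q i \<bullet> (S *v q i)) + \<gamma>1 * real CARD('n) * \<bar>t\<bar>
        + \<gamma>2 * (2 * t * d i + t\<^sup>2)" by fastforce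
    moreover have "\<bar>t / d i\<bar> \<le> 1 / 2" using t d[of i] by (simp add: abs_div field_simps)
    from abs_ln_one_plus_x_minus_x_bound[OF this]
    have "t / d i - 2 * (t / d i)\<^sup>2 \<le> ln (1 + t / d i)" by linarith
    moreover have "\<gamma>2 * t\<^sup>2 \<le> \<bar>\<gamma>2\<bar> * t\<^sup>2" by (simp add: mult_right_mono)
    ultimately show ?thesis
      by (simp add: g_def C_def algebra_simps power_divide)
  qed
  have "\<bar>g\<bar> \<le> \<gamma>1 * real CARD('n) + e" if "0 < e" for e
  proof -
    \<comment> \<open>The first bound makes \<open>key\<close> applicable, the second makes the
      error \<open>t * C\<close> at most \<open>e\<close>; the summand 1 keeps the denominator
      positive.\<close>
    define t where "t = min (d i / 2) (e / (C + 1))"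
    have t: "0 < t" "t \<le> d i / 2"
      using d[of i] C that unfolding t_def by (simp, intro min.cobounded1)
    have "t * C \<le> e / (C + 1) * C" using C by (intro mult_right_mono) (auto simp: t_def)
    also have "\<dots> \<le> e" using C that by (simp add: field_simps)
    finally have tC: "t * C \<le> e" .
    have "0 \<le> t * (g + \<gamma>1 * real CARD('n) + t * C)" "0 \<le> t * (- g + \<gamma>1 * real CARD('n) + t * C)"
      using key[of t] key[of "- t"] t by (simp_all add: algebra_simps power2_eq_square)
    then have "0 \<le> g + \<gamma>1 * real CARD('n) + t * C" "0 \<le> - g + \<gamma>1 * real CARD('n) + t * C"
      using t(1) by (simp_all add: zero_le_mult_iff)
    then show ?thesis using tC by linarith
  qed
  then show ?thesis unfolding g_def by (rule field_le_epsilon)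
qed

section \<open>Quadratic inequalities and the conclusion\<close>

text \<open>Multiplying by \<open>u\<close> gives \<open>u\<^sup>2 - a * u - c \<le> 0\<close>;
  completing the square bounds \<open>u\<close> by the larger root.\<close>

lemma positive_root_ge:
  fixes u a c :: real
  assumes "0 < u" "0 \<le> c" "u - c / u \<le> a"
  shows "u \<le> (a + sqrt (a\<^sup>2 + 4 * c)) / 2"
proof -
  have "u * (u - c / u) \<le> u * a" using assms by (intro mult_left_mono) auto
  then have "(2 * u - a)\<^sup>2 \<le> a\<^sup>2 + 4 * c"
    using assms(1) by (simp add: algebra_simps power2_eq_square)
  then have "2 * u - a \<le> sqrt (a\<^sup>2 + 4 * c)" by (rule real_le_rsqrt)
  then show ?thesis by simp
qed

lemma positive_root_le:
  fixes u b c :: real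
  assumes "0 < u" "0 \<le> c" "b \<le> u - c / u"
  shows "(b + sqrt (b\<^sup>2 + 4 * c)) / 2 \<le> u"
proof -
  have "u * b \<le> u * (u - c / u)" using assms by (intro mult_left_mono) auto
  then have "b\<^sup>2 + 4 * c \<le> (2 * u - b)\<^sup>2"
    using assms(1) by (simp add: algebra_simps power2_eq_square)
  \<comment> \<open>This makes \<open>2 * u - b\<close> positive, so square roots may be taken in
    the preceding inequality.\<close>
  moreover have "b \<le> u" using assms by (smt (verit) divide_nonneg_pos)
  ultimately have "sqrt (b\<^sup>2 + 4 * c) \<le> 2 * u - b" using assms(1) by (intro real_le_lsqrt) auto
  then show ?thesis by simp
qed

theorem lemma1:
  fixes S \<Omega> :: "real^'n^'n" and \<gamma>1 \<gamma>2 \<alpha> \<beta> :: real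
  assumes "transpose S = S"
    and "\<gamma>1 > 0" and "\<gamma>2 > 0"
    and "is_arg_min (penalized_objective S \<gamma>1 \<gamma>2) (\<lambda>\<Theta>. \<Theta> \<in> spd_matrices) \<Omega>"
    and "\<alpha> = inverse (1 / 2 * (eigval 1 S + \<gamma>1 * real CARD('n)
               + sqrt ((eigval 1 S + \<gamma>1 * real CARD('n))\<^sup>2 + 8 * \<gamma>2)))"
    and "\<beta> = inverse (1 / 2 * (eigval CARD('n) S - \<gamma>1 * real CARD('n)
               + sqrt ((eigval CARD('n) S - \<gamma>1 * real CARD('n))\<^sup>2 + 8 * \<gamma>2)))"
  shows "\<alpha> *\<^sub>R mat 1 \<preceq> \<Omega> \<and> \<Omega> \<preceq> \<beta> *\<^sub>R mat 1"
proof -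
  have spd: "\<Omega> \<in> spd_matrices" using assms(4) by (simp add: is_arg_min_def)
  then obtain q d where q: "orthonormal_family q" "\<Omega> = spectral_matrix q d"
    using spectral_decomposition[of \<Omega>] by (auto simp: spd_matrices_def)
  have d: "0 < d i" for i using spd q by (simp add: spectral_matrix_spd_iff)
  let ?a = "eigval 1 S + \<gamma>1 * real CARD('n)" and ?b = "eigval CARD('n) S - \<gamma>1 * real CARD('n)"
  have bounds: "\<alpha> \<le> d i \<and> d i \<le> \<beta>" for i
  proof -
    have "norm (q i) = 1" using q(1) by (simp add: orthonormal_family_def norm_eq_1)
    note ray = rayleigh_bounds[OF assms(1) this]
    have stat: "\<bar>q i \<bullet> (S *v q i) - 1 / d i + 2 * \<gamma>2 * d i\<bar> \<le> \<gamma>1 * real CARD('n)"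
      using assms(2,4) unfolding q(2) by (intro minimizer_stationarity q(1) d) auto
    \<comment> \<open>In terms of \<open>u\<close> the stationarity bound says that
      \<open>u - 2 * \<gamma>2 / u\<close> is within \<open>\<gamma>1 * real CARD('n)\<close> of the
      Rayleigh quotient. The root lemmas then apply with \<open>c = 2 * \<gamma>2\<close>, whence
      the \<open>8 * \<gamma>2\<close> under the root.\<close>
    define u where "u = inverse (d i)"
    have u: "0 < u" "1 / d i = u" "d i = inverse u" "2 * \<gamma>2 * d i = 2 * \<gamma>2 / u"
      using d[of i] by (simp_all add: u_def divide_inverse)
    have "u - 2 * \<gamma>2 / u \<le> ?a" "?b \<le> u - 2 * \<gamma>2 / u"
      using stat ray unfolding u(2,4) by linarith+
    then have "u \<le> inverse \<alpha>" "inverse \<beta> \<le> u"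
      using positive_root_ge[of u "2 * \<gamma>2" ?a] positive_root_le[of u "2 * \<gamma>2" ?b] u(1) assms(3)
      unfolding assms(5,6) inverse_inverse_eq by simp_all
    \<comment> \<open>Since \<open>?b\<close> may be negative, positivity of
      \<open>inverse \<beta>\<close> rests on this strict inequality, which comes from
      \<open>\<gamma>2 > 0\<close>; it is needed to invert
      \<open>inverse \<beta> \<le> u\<close>.\<close>
    moreover have "\<bar>?b\<bar> < sqrt (?b\<^sup>2 + 8 * \<gamma>2)"
      using assms(3) by (intro real_less_rsqrt) simp
    then have "0 < inverse \<beta>" unfolding assms(6) inverse_inverse_eq by simp
    ultimately show ?thesis
      unfolding u(3) using le_imp_inverse_le[of u "inverse \<alpha>"] le_imp_inverse_le[of "inverse \<beta>" u] u(1)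
      by simp
  qed
  show ?thesis
    using spectral_matrix_loewner[OF q(1)] bounds q(2) by blast
qed

end
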